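(* Let $P$ be a $\Sigma$-pattern with first symbol in $\Sigma$, with exactly one gap, of prime length $p$, such that $\mathrm{T}(P)$ is completely additive and not the constant zero sequence. Let $g$ be a primitive root modulo $p$ (with $g=1$ if $p=2$). Then $P=(\lambda_{p,g}\cdot P(g))\,\rho_d$ for some $d\in\Sigma$, where $P(g)$ is the $g$-th letter of $P$.
   Context: $\Sigma=\mathbb{Z}/k\mathbb{Z}$ is a fixed finite cyclic group. Gaps are elements of $\mathrm{S}_\Sigma$, the bijections of $\Sigma$; $\rho_d$ is $x\mapsto x+d$, $?$ the identity. A $\Sigma$-pattern is a nonempty word over $\Sigma\cup\mathrm{S}_\Sigma$, indexed $P(1)\dots P(|P|)$. For words $x,y$: $(a\,x)\langle y\rangle=a\,x\langle y\rangle$, $(f\,x)\langle b\,y\rangle=f(b)\,x\langle y\rangle$, $(f\,x)\langle g\,y\rangle=(f\circ g)\,x\langle y\rangle$. For $P$ with first symbol in $\Sigma$: $T_0=?^\omega$, $T_{i+1}=P^\omega\langle T_i\rangle$, $\mathrm{T}(P)=\lim_iT_i$, indexed by positive integers. Completely additive: $\sigma(1)=0$, $\sigma(nm)=\sigma(n)+\sigma(m)$. For a word $w=w_1\dots w_r$ over $\{0,1,\dots\}$ and $c\in\Sigma$, $w\cdot c=(w_1c)\dots(w_rc)$ with $jc=c+\dots+c$ ($j$ times). For odd prime $p$ and primitive root $g$, $\lambda_{p,g}=\log_g(1)\log_g(2)\cdots\log_g(p-1)$ with $\log_g(a)\in\{0,\dots,p-2\}$ the discrete logarithm; $\lambda_{2,1}=0$.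 Convention: if $\mathrm{T}(P)$ is not surjective onto $\Sigma$, a gap in $P$ is identified with every bijection agreeing with it on the letters occurring in $\mathrm{T}(P)$; equality of patterns is modulo this identification. *)

theory Defs
  imports
    "HOL-Library.Stream"
    "HOL-Number_Theory.Residue_Primitive_Roots"
    "Berlekamp_Zassenhaus.Finite_Field"
begin

section \<open>Patterns and Toeplitz substitution\<close>

text \<open>
  The alphabet is the cyclic group of integers modulo \<open>CARD('k)\<close>, i.e.\ the type \<open>'k mod_ring\<close>
  with \<open>'k :: finite\<close>. The notions that do not depend on it are stated over an arbitrary
  alphabet \<open>'a\<close>.
\<close>

datatype 'a symbol = Letter 'a | Gap "'a \<Rightarrow> 'a"

text \<open>Gaps of arbitrary type \<open>'a \<Rightarrow> 'a\<close> are restricted to bijections here.\<close>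

definition is_pattern :: "'a symbol list \<Rightarrow> bool" where
  "is_pattern P \<longleftrightarrow> P \<noteq> [] \<and> (\<forall>f. Gap f \<in> set P \<longrightarrow> bij f)"

definition gap_positions :: "'a symbol list \<Rightarrow> nat set" where
  "gap_positions P = {i. i < length P \<and> (\<exists>f. P ! i = Gap f)}"

fun fill :: "('a \<Rightarrow> 'a) \<Rightarrow> 'a symbol \<Rightarrow> 'a symbol" where
  "fill f (Letter b) = Letter (f b)"
| "fill f (Gap g) = Gap (f \<circ> g)"

primcorec subst_word :: "'a symbol stream \<Rightarrow> 'a symbol stream \<Rightarrow> 'a symbol stream" where
  "shd (subst_word x y) =
     (case shd x of Letter a \<Rightarrow> Letter a | Gap f \<Rightarrow> fill f (shd y))"
| "stl (subst_word x y) =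
     subst_word (stl x) (case shd x of Letter a \<Rightarrow> y | Gap f \<Rightarrow> stl y)"

primrec toeplitz_iter :: "'a symbol list \<Rightarrow> nat \<Rightarrow> 'a symbol stream" where
  "toeplitz_iter P 0 = sconst (Gap id)"
| "toeplitz_iter P (Suc i) = subst_word (cycle P) (toeplitz_iter P i)"

text \<open>
  The limit word, indexed by positive integers (the value at 0 is meaningless). Convergence is
  with respect to the product of the discrete topologies, so a position has the letter on which
  the iterates eventually agree; see \<open>toeplitz_limit\<close> below.
\<close>

definition toeplitz :: "'a symbol list \<Rightarrow> nat \<Rightarrow> 'a" where
  "toeplitz P n = (THE a. \<forall>\<^sub>F i in sequentially. toeplitz_iter P i !! (n - 1) = Letter a)"

lemma subst_word_snth:
  "subst_word x y !! n =
     (case x !! n of Letter a \<Rightarrow> Letter a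
      | Gap f \<Rightarrow> fill f (y !! card {i. i < n \<and> (\<exists>f. x !! i = Gap f)}))"
proof (induction n arbitrary: x y)
  case 0
  then show ?case by (simp split: symbol.splits)
next
  case (Suc n)
  let ?G = "\<lambda>x n. {i. i < n \<and> (\<exists>f. x !! i = Gap f)}"
  have split: "?G x (Suc n) = (if \<exists>f. shd x = Gap f then {0} else {}) \<union> Suc ` ?G (stl x) n"
    by (auto simp: image_iff less_Suc_eq_0_disj)
  have "card (?G x (Suc n)) = (if \<exists>f. shd x = Gap f then 1 else 0) + card (?G (stl x) n)"
    unfolding split by (subst card_Un_disjoint) (auto simp: card_image)
  then show ?case
    using Suc.IH[of "stl x"] by (auto split: symbol.splits)
qed

lemma toeplitz_limit:
  assumes "P \<noteq> []" and "hd P = Letter c" and "n \<ge> 1"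
  shows "\<forall>\<^sub>F i in sequentially. toeplitz_iter P i !! (n - 1) = Letter (toeplitz P n)"
proof -
  have ex: "\<exists>a. \<forall>i\<ge>n. toeplitz_iter P (Suc i) !! n = Letter a" for n
  proof (induction n rule: less_induct)
    case (less n)
    show ?case
    proof (cases "cycle P !! n")
      case (Letter a)
      then show ?thesis by (simp add: subst_word_snth)
    next
      case (Gap f)
      let ?m = "card {i. i < n \<and> (\<exists>f. cycle P !! i = Gap f)}"
      have first: "cycle P !! 0 = Letter c"
        using assms(1,2) by (simp add: cycle.simps(1))
      then have "n \<noteq> 0" using Gap by (metis symbol.distinct(1))
      have "?m \<le> card {0<..<n}"
        using first by (intro card_mono) (auto intro!: gr0I simp del: snth.simps)
      then have m: "?m < n" using \<open>n \<noteq> 0\<close> by simp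
      then obtain a where a: "\<forall>i\<ge>?m. toeplitz_iter P (Suc i) !! ?m = Letter a"
        using less by blast
      have "toeplitz_iter P (Suc i) !! n = Letter (f a)" if "i \<ge> n" for i
      proof -
        define j where "j = i - 1"
        have "i = Suc j" "j \<ge> ?m" using m that by (auto simp: j_def)
        then show ?thesis using a Gap by (simp add: subst_word_snth del: toeplitz_iter.simps(2)
              add: toeplitz_iter.simps(2)[of P "Suc j"])
      qed
      then show ?thesis by blast
    qed
  qed
  obtain a where "\<forall>i\<ge>n - 1. toeplitz_iter P (Suc i) !! (n - 1) = Letter a"
    using ex by blast
  then have "\<forall>i\<ge>n. toeplitz_iter P i !! (n - 1) = Letter a"
    using assms(3) by (metis Suc_le_D Suc_le_mono diff_Suc_1 One_nat_def)
  then have ev: "\<forall>\<^sub>F i in sequentially. toeplitz_iter P i !! (n - 1) = Letter a"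
    by (auto simp: eventually_sequentially)
  have "b = a" if "\<forall>\<^sub>F i in sequentially. toeplitz_iter P i !! (n - 1) = Letter b" for b
  proof -
    from that ev have "\<forall>\<^sub>F i in sequentially. b = a" by eventually_elim simp
    then show ?thesis by simp
  qed
  with ev show ?thesis unfolding toeplitz_def
    by (rule theI[where P = "\<lambda>a. \<forall>\<^sub>F i in sequentially. toeplitz_iter P i !! (n - 1) = Letter a"])
qed

section \<open>Equality of patterns\<close>

text \<open>
  Gaps are identified when they agree on the set \<open>A\<close> of letters occurring in \<open>T(P)\<close>. When
  \<open>A\<close> is the whole alphabet this is plain equality.
\<close>

definition symbol_eq :: "'a set \<Rightarrow> 'a symbol \<Rightarrow> 'a symbol \<Rightarrow> bool" where
  "symbol_eq A s t \<longleftrightarrow>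
     s = t \<or> (\<exists>f g. s = Gap f \<and> t = Gap g \<and> (\<forall>x\<in>A. f x = g x))"

definition pattern_eq :: "'a symbol list \<Rightarrow> 'a symbol list \<Rightarrow> bool" where
  "pattern_eq P Q \<longleftrightarrow> list_all2 (symbol_eq (toeplitz P ` {1..})) P Q"

section \<open>Completely additive sequences and discrete logarithms\<close>

definition completely_additive :: "(nat \<Rightarrow> 'a::ab_group_add) \<Rightarrow> bool" where
  "completely_additive \<sigma> \<longleftrightarrow>
     \<sigma> 1 = 0 \<and> (\<forall>n\<ge>1. \<forall>m\<ge>1. \<sigma> (n * m) = \<sigma> n + \<sigma> m)"

definition rotation :: "'a::ab_group_add \<Rightarrow> 'a \<Rightarrow> 'a" where
  "rotation d = (\<lambda>x. x + d)"

definition scale_word :: "nat list \<Rightarrow> 'a::ab_group_add \<Rightarrow> 'a list" where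
  "scale_word w c = map (\<lambda>j. \<Sum>i<j. c) w"

definition dlog :: "nat \<Rightarrow> nat \<Rightarrow> nat \<Rightarrow> nat" where
  "dlog p g a = (THE j. j \<in> {0..<p - 1} \<and> [g ^ j = a] (mod p))"

definition log_word :: "nat \<Rightarrow> nat \<Rightarrow> nat list" where
  "log_word p g = map (dlog p g) [1..<p]"

lemma log_word_2_1: "log_word 2 1 = [0]"
  by (auto simp: log_word_def dlog_def upt_rec)

lemma dlog_properties:
  assumes "prime p" and "residue_primroot p g" and "a \<in> {1..<p}"
  shows "dlog p g a \<in> {0..<p - 1}" and "[g ^ dlog p g a = a] (mod p)"
proof -
  have tot: "totatives p = {1..<p}"
    using assms(1) by (auto simp: totatives_prime)
  have bij: "bij_betw (\<lambda>i. g ^ i mod p) {..<totient p} (totatives p)"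
    using assms(1,2) using prime_gt_1_nat by (intro residue_primroot_is_generator) auto
  then obtain j where j: "j < totient p" "g ^ j mod p = a"
    proof -
    have "a \<in> (\<lambda>i. g ^ i mod p) ` {..<totient p}"
      using assms(3) bij_betw_imp_surj_on[OF bij] tot by simp
    then show ?thesis using that by blast
  qed
  have "\<exists>!j. j \<in> {0..<p - 1} \<and> [g ^ j = a] (mod p)"
  proof (rule ex1I[of _ j])
    show "j \<in> {0..<p - 1} \<and> [g ^ j = a] (mod p)"
      using j assms(1,3) by (auto simp: totient_prime cong_def)
    show "i = j" if "i \<in> {0..<p - 1} \<and> [g ^ i = a] (mod p)" for i
      using that j assms bij_betw_imp_inj_on[OF bij]
      by (auto simp: totient_prime cong_def inj_on_def)
  qed
  from theI'[OF this] show "dlog p g a \<in> {0..<p - 1}" "[g ^ dlog p g a = a] (mod p)"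
    unfolding dlog_def by auto
qed

end

(* If the gap were not the last symbol, then \<sigma>(pn) would be the constant letter P(p), so
   \<sigma>(n) = \<sigma>(pn) - \<sigma>(p) would vanish for all n. Hence \<sigma> depends only on the residue modulo p on
   the integers prime to p, so that \<sigma>(a) = \<sigma>(g^j) = j \<sigma>(g) for a = g^j modulo p, while the gap f
   satisfies f(\<sigma>(n)) = \<sigma>(pn) = \<sigma>(n) + \<sigma>(p). *)

theory Submission
  imports Defs
begin

lemma cycle_snth:
  assumes "u \<noteq> []"
  shows "cycle u !! n = u ! (n mod length u)"
proof -
  have "cycle u !! n = shd (sdrop n (cycle u))" by simp
  also have "\<dots> = hd (rotate (n mod length u) u)"
    using assms by (simp add: sdrop_cycle cycle.simps)
  finally show ?thesis using assms by (simp add: hd_rotate_conv_nth)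
qed

text \<open>A letter of \<open>cycle P\<close> survives every substitution, so it is present in all
  iterates except \<open>toeplitz_iter P 0\<close>, which consists of gaps.\<close>

lemma toeplitz_letter:
  assumes "P \<noteq> []" "hd P = Letter c" "n \<ge> 1" "P ! ((n - 1) mod length P) = Letter a"
  shows "toeplitz P n = a"
proof -
  have "\<forall>\<^sub>F i in sequentially. toeplitz_iter P i !! (n - 1) = Letter a"
    unfolding eventually_sequentially
  proof (intro exI[of _ 1] allI impI)
    fix i :: nat assume "1 \<le> i"
    then obtain j where "i = Suc j" by (cases i) auto
    then show "toeplitz_iter P i !! (n - 1) = Letter a"
      using assms by (simp add: subst_word_snth cycle_snth)
  qed
  with toeplitz_limit[OF assms(1-3)]
  have "\<forall>\<^sub>F i in sequentially. toeplitz P n = a" by eventually_elim simp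
  then show ?thesis by simp
qed

text \<open>This is the recursion of \<open>toeplitz_iter\<close> passed to the limit. The
  cardinality counts the earlier gaps, which use up that many letters of the inner word;
  \<open>Suc\<close> turns this 0-based index into a 1-based one.\<close>

lemma toeplitz_gap:
  assumes "P \<noteq> []" "hd P = Letter c" "n \<ge> 1" "P ! ((n - 1) mod length P) = Gap f"
  shows "toeplitz P n =
    f (toeplitz P (Suc (card {i. i < n - 1 \<and> (\<exists>h. P ! (i mod length P) = Gap h)})))"
    (is "_ = f (toeplitz P (Suc ?m))")
proof -
  have "\<forall>\<^sub>F i in sequentially. toeplitz_iter P i !! ?m = Letter (toeplitz P (Suc ?m))"
    using toeplitz_limit[OF assms(1,2), of "Suc ?m"] by simp
  moreover have "\<forall>\<^sub>F i in sequentially. toeplitz_iter P (Suc i) !! (n - 1) = Letter (toeplitz P n)"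
    using toeplitz_limit[OF assms(1-3)] by (subst eventually_sequentially_Suc)
  ultimately have "\<forall>\<^sub>F i in sequentially. toeplitz P n = f (toeplitz P (Suc ?m))"
    by eventually_elim (use assms in \<open>simp add: subst_word_snth cycle_snth\<close>)
  then show ?thesis by simp
qed

text \<open>If the only gap ends the period, this counts the gaps before the \<open>m\<close>-th
  one, at 1-based position \<open>p * m\<close>. That gap therefore receives the \<open>m\<close>-th
  letter.\<close>

lemma card_last_residue:
  fixes p m :: nat
  assumes "p > 0" "m > 0"
  shows "card {i. i < p * m - 1 \<and> i mod p = p - 1} = m - 1"
proof -
  have "i \<in> (\<lambda>j. p * j + (p - 1)) ` {..<m - 1}" if i: "i < p * m - 1" "i mod p = p - 1" for i
  proof -
    have eq: "i = p * (i div p) + (p - 1)" using i(2) by (metis mult_div_mod_eq)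
    \<comment> \<open>The left side is \<open>i + 1\<close>, so the bound on \<open>i\<close>
      becomes a comparison of multiples of \<open>p\<close>.\<close>
    then have "p * Suc (i div p) < p * m" using i(1) assms(1) by simp
    then have "Suc (i div p) < m" by (simp only: mult_less_cancel1)
    then show ?thesis using eq by (intro image_eqI[of _ _ "i div p"]) auto
  qed
  moreover have "p * j + (p - 1) < p * m - 1" if "j < m - 1" for j
  proof -
    have "p * Suc j < p * m" using assms(1) that by (simp del: mult_Suc_right)
    then show ?thesis using assms(1) by simp
  qed
  moreover have "(p * j + (p - 1)) mod p = p - 1" for j
    using assms(1) by (simp only: mod_mult_self4) simp
  ultimately have "{i. i < p * m - 1 \<and> i mod p = p - 1} = (\<lambda>j. p * j + (p - 1)) ` {..<m - 1}"
    by blast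
  moreover have "inj_on (\<lambda>j. p * j + (p - 1)) {..<m - 1}"
    using assms(1) by (intro inj_onI) (simp only: add_right_cancel mult_cancel1, simp)
  ultimately show ?thesis by (simp add: card_image)
qed

lemma completely_additive_power:
  assumes "completely_additive \<sigma>" "g \<ge> 1"
  shows "\<sigma> (g ^ j) = (\<Sum>i<j. \<sigma> g)"
proof (induction j)
  case 0
  then show ?case using assms by (simp add: completely_additive_def)
next
  case (Suc j)
  have "\<sigma> (g * g ^ j) = \<sigma> g + \<sigma> (g ^ j)"
    using assms unfolding completely_additive_def by (metis one_le_power)
  then show ?case using Suc by (simp only: power_Suc sum.lessThan_Suc add.commute)
qed

theorem mainTheorem7:
  fixes P :: "('k::finite) mod_ring symbol list" and p g :: nat
  assumes "is_pattern P"
    and "\<exists>a. hd P = Letter a"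
    and "card (gap_positions P) = 1"
    and "prime p" and "length P = p"
    and "completely_additive (toeplitz P)"
    and "\<exists>n\<ge>1. toeplitz P n \<noteq> 0"
    and "residue_primroot p g" and "g \<in> {1..<p}"
  shows "\<exists>c d. P ! (g - 1) = Letter c \<and>
    pattern_eq P (map Letter (scale_word (log_word p g) c) @ [Gap (rotation d)])"
proof -
  let ?\<sigma> = "toeplitz P"
  have p: "p > 1" using assms(4) by (rule prime_gt_1_nat)
  have P: "P \<noteq> []" using assms(1) by (simp add: is_pattern_def)
  obtain a where a: "hd P = Letter a" using assms(2) by blast
  note letter = toeplitz_letter[OF P a, unfolded assms(5)]
  have add: "?\<sigma> (n * m) = ?\<sigma> n + ?\<sigma> m" if "n \<ge> 1" "m \<ge> 1" for n m
    using assms(6) that by (auto simp: completely_additive_def)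
  have last_mod: "(p * n - 1) mod p = p - 1" if n: "n \<ge> 1" for n
  proof -
    have "p * n - 1 = p * (n - 1) + (p - 1)"
      using n p by (cases n) auto
    then show ?thesis using p by (simp only: mod_mult_self4) simp
  qed
  obtain f where f: "P ! (p - 1) = Gap f"
  proof (cases "P ! (p - 1)")
    case (Letter b)
    have b: "?\<sigma> (p * n) = b" if "n \<ge> 1" for n
      using that p Letter last_mod[OF that] by (intro letter) auto
    have "?\<sigma> n = 0" if "n \<ge> 1" for n
      using add[of p n] b[OF that] b[of 1] that p by simp
    then show ?thesis using assms(7) by blast
  qed
  obtain q where "gap_positions P = {q}"
    using assms(3) by (rule card_1_singletonE)
  moreover have "p - 1 \<in> gap_positions P"
    using f p assms(5) by (simp add: gap_positions_def)
  ultimately have gaps: "gap_positions P = {p - 1}" by simp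
  then have gap_iff: "(\<exists>h. P ! i = Gap h) \<longleftrightarrow> i = p - 1" if "i < p" for i
    using that assms(5) by (auto simp: gap_positions_def)
  have sigma_letter: "P ! i = Letter (?\<sigma> (Suc i))" if "i < p - 1" for i
  proof (cases "P ! i")
    case (Letter b)
    then show ?thesis using letter[of "Suc i" b] that by simp
  next
    case (Gap h)
    then have "i = p - 1" using gap_iff[of i] that by fastforce
    then show ?thesis using that by simp
  qed
  have sigma_mod: "?\<sigma> n = ?\<sigma> (n mod p)" if "\<not> p dvd n" for n
  proof -
    have pos: "0 < n mod p" using that by (simp add: dvd_eq_mod_eq_0)
    \<comment> \<open>As the residue is positive, subtracting 1 does not wrap around.\<close>
    have eq: "(n - 1) mod p = n mod p - 1"
      using pos by (metis Suc_pred' diff_Suc_1 mod_Suc mod_0 not_gr_zero)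
    \<comment> \<open>The 0-based index stays clear of the gap at \<open>p - 1\<close>, so position
      \<open>n\<close> shows a letter of \<open>P\<close>, the same as at position
      \<open>n mod p\<close>.\<close>
    have "n mod p - 1 < p - 1" using pos p by (simp add: diff_less_mono)
    then have "P ! (n mod p - 1) = Letter (?\<sigma> (n mod p))"
      using sigma_letter pos by fastforce
    then show ?thesis using that eq by (intro letter) (auto intro!: Suc_leI gr0I)
  qed
  have gap: "f (?\<sigma> n) = ?\<sigma> n + ?\<sigma> p" if n: "n \<ge> 1" for n
  proof -
    have set_eq: "{i. i < p * n - 1 \<and> (\<exists>h. P ! (i mod p) = Gap h)} =
        {i. i < p * n - 1 \<and> i mod p = p - 1}"
      using gap_iff p by simp
    have "?\<sigma> (p * n) = f (?\<sigma> (Suc (n - 1)))"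
      using toeplitz_gap[OF P a, of "p * n" f, unfolded assms(5) set_eq]
        card_last_residue[of p n] last_mod[OF n] f n p by simp
    then show ?thesis using add[of p n] n p by (simp add: add.commute)
  qed
  have dlog: "?\<sigma> b = (\<Sum>i<dlog p g b. ?\<sigma> g)" if b: "b \<in> {1..<p}" for b
  proof -
    have cong: "g ^ dlog p g b mod p = b"
      using dlog_properties(2)[OF assms(4,8) b] b by (simp add: cong_def)
    \<comment> \<open>The power itself may exceed \<open>p\<close>; being prime to \<open>p\<close>,
      it can be replaced by its residue \<open>b\<close> inside \<open>?\<sigma>\<close>.\<close>
    then have "\<not> p dvd g ^ dlog p g b" using b by (auto simp: dvd_eq_mod_eq_0)
    then have "?\<sigma> (g ^ dlog p g b) = ?\<sigma> b" using sigma_mod cong by simp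
    then show ?thesis using completely_additive_power[OF assms(6), of g] assms(9) by simp
  qed
  \<comment> \<open>The rotation amount \<open>?\<sigma> p\<close> is \<open>f 0\<close>, by
    \<open>gap\<close> at 1, where \<open>?\<sigma>\<close> vanishes.\<close>
  have "pattern_eq P (map Letter (scale_word (log_word p g) (?\<sigma> g)) @ [Gap (rotation (?\<sigma> p))])"
    unfolding pattern_eq_def list_all2_conv_all_nth
  proof (intro conjI allI impI)
    fix i assume "i < length P"
    then consider "i < p - 1" | "i = p - 1" using assms(5) by linarith
    then show "symbol_eq (?\<sigma> ` {1..}) (P ! i)
        ((map Letter (scale_word (log_word p g) (?\<sigma> g)) @ [Gap (rotation (?\<sigma> p))]) ! i)"
    proof cases
      case 1
      then show ?thesis using sigma_letter[of i] dlog[of "Suc i"]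
        by (simp add: symbol_eq_def nth_append scale_word_def log_word_def)
    next
      case 2
      \<comment> \<open>\<open>gap\<close> describes \<open>f\<close> on the values of
        \<open>?\<sigma>\<close> at positive integers, which is exactly the set on which
        \<open>symbol_eq\<close> compares the two gaps.\<close>
      then show ?thesis using f gap
        by (simp add: symbol_eq_def nth_append scale_word_def log_word_def rotation_def)
    qed
  qed (use assms(5) p in \<open>simp add: scale_word_def log_word_def\<close>)
  moreover have "P ! (g - 1) = Letter (?\<sigma> g)"
    using sigma_letter[of "g - 1"] assms(9) by auto
  ultimately show ?thesis by blast
qed

end
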